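(* For every integer $d \ge 2$ there exists an integer $N = N(d)$ such that the following holds. Let $a_1,\dots,a_n \in \mathbb{Z}^d$ be $n$ distinct lattice points which are exactly the vertices of a lattice polytope in $\mathbb{R}^d$, and suppose the vectors $(1,a_1),\dots,(1,a_n)$ generate $\mathbb{Z}^{d+1}$ as a group. Let $A$ be the $(d+1)\times n$ integer matrix whose $j$-th column is $(1,a_j)$. If $n \ge N$, then the toric ideal $I_A \subset \mathbb{C}[x_1,\dots,x_n]$ does not contain any complete intersection basis ideal; that is, for every $\mathbb{Q}$-basis $B=\{v_1,\dots,v_r\}$ of $\mathcal{L}_A\otimes\mathbb{Q}$ consisting of vectors of $\mathcal{L}_A$ (with $r=n-d-1$), the ideal $J_B$ is not a complete intersection.
   Context: For an integer $m\times n$ matrix $A$ of rank $m$, put $r = n-m$ and $\mathcal{L}_A = \{v\in\mathbb{Z}^n : A\cdot v = 0\}$, a lattice of rank $r$. The toric ideal $I_A\subset \mathbb{C}[x_1,\dots,x_n]$ is the ideal generated by all binomials $x^u - x^v$ with $u,v\in\mathbb{N}^n$ and $A\cdot u = A\cdot v$. For $v\in\mathbb{Z}^n$ write $v = v^+ - v^-$, where $v^+,v^-\in\mathbb{N}^n$ have disjoint supports (positive and negative parts). Let $B = \{v_1,\dots,v_r\}\subset\mathcal{L}_A$ be a set of $r$ vectors linearly independent over $\mathbb{Q}$. The basis ideal $J_B$ is the ideal of $\mathbb{C}[x_1,\dots,x_n]$ generated by the $r$ binomials $x^{v_j^+} - x^{v_j^-}$, $j=1,\dots,r$; it is contained in $I_A$.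 The ideal $J_B$ is a complete intersection if its height (codimension) equals $r$. In the claim, $m=d+1$. *)

theory Defs
  imports
    "HOL-Analysis.Analysis"
    "HOL-Algebra.Ideal"
    "HOL-Library.Poly_Mapping"
    "HOL-Library.Extended_Nat"
    "HOL-Computational_Algebra.Group_Closure"
begin

definition prime_height :: "('a, 'b) ring_scheme \<Rightarrow> 'a set \<Rightarrow> enat" where
  "prime_height R P = Sup {enat k | k. \<exists>C :: nat \<Rightarrow> 'a set.
     (\<forall>i\<le>k. primeideal (C i) R) \<and> (\<forall>i<k. C i \<subset> C (Suc i)) \<and> C k = P}"

definition ideal_height :: "('a, 'b) ring_scheme \<Rightarrow> 'a set \<Rightarrow> enat" where
  "ideal_height R I = Inf {prime_height R P | P. primeideal P R \<and> I \<subseteq> P}"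

text \<open>
  The number \<open>n\<close> of variables is a term, not a type, because the bound in the theorem, which
  depends on the dimension only, precedes the quantifier over \<open>n\<close>. The variables are
  indexed by \<open>0, \<dots>, n - 1\<close>.
\<close>

type_synonym cpoly = "(nat \<Rightarrow>\<^sub>0 nat) \<Rightarrow>\<^sub>0 complex"

definition poly_ring :: "nat \<Rightarrow> cpoly ring" where
  "poly_ring n = \<lparr>carrier = {p. \<forall>u \<in> Poly_Mapping.keys p. Poly_Mapping.keys u \<subseteq> {..<n}},
     monoid.mult = (*), one = 1, ring.zero = 0, add = (+)\<rparr>"

lemma cring_poly_ring: "cring (poly_ring n)"
proof (rule cringI)
  let ?C = "{p :: cpoly. \<forall>u \<in> Poly_Mapping.keys p. Poly_Mapping.keys u \<subseteq> {..<n}}"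
  have add: "p + q \<in> ?C" if "p \<in> ?C" "q \<in> ?C" for p q
    using that Poly_Mapping.keys_add[of p q] by blast
  have mult: "p * q \<in> ?C" if "p \<in> ?C" "q \<in> ?C" for p q
  proof -
    have "Poly_Mapping.keys w \<subseteq> {..<n}" if w: "w \<in> Poly_Mapping.keys (p * q)" for w
    proof -
      obtain a b where "w = a + b" "a \<in> Poly_Mapping.keys p" "b \<in> Poly_Mapping.keys q"
        using w Poly_Mapping.keys_mult[of p q] by blast
      then show ?thesis
        using \<open>p \<in> ?C\<close> \<open>q \<in> ?C\<close> Poly_Mapping.keys_add[of a b] by blast
    qed
    then show ?thesis by simp
  qed
  have carrier: "carrier (poly_ring n) = ?C"
    by (simp add: poly_ring_def)
  have ops: "x \<oplus>\<^bsub>poly_ring n\<^esub> y = x + y" "x \<otimes>\<^bsub>poly_ring n\<^esub> y = x * y" for x y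
    by (simp_all add: poly_ring_def)
  have neutral: "\<zero>\<^bsub>poly_ring n\<^esub> = 0" "\<one>\<^bsub>poly_ring n\<^esub> = 1"
    by (simp_all add: poly_ring_def)
  show "abelian_group (poly_ring n)"
  proof (rule abelian_groupI, unfold carrier ops neutral)
    fix x assume "x \<in> ?C"
    then show "\<exists>y\<in>?C. y + x = 0"
      by (intro bexI[of _ "- x"]) simp_all
  qed (fact add | simp add: ac_simps)+
  show "comm_monoid (poly_ring n)"
    by (rule comm_monoidI, unfold carrier ops neutral) (fact mult | simp add: ac_simps)+
  show "(x \<oplus>\<^bsub>poly_ring n\<^esub> y) \<otimes>\<^bsub>poly_ring n\<^esub> z =
      x \<otimes>\<^bsub>poly_ring n\<^esub> z \<oplus>\<^bsub>poly_ring n\<^esub> y \<otimes>\<^bsub>poly_ring n\<^esub> z" for x y z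
    unfolding ops by (rule distrib_right)
qed

definition monomial :: "(nat \<Rightarrow>\<^sub>0 nat) \<Rightarrow> cpoly" where
  "monomial u = Poly_Mapping.single u 1"

text \<open>
  An integer matrix with \<open>n\<close> columns is given by its columns \<open>A 0, \<dots>, A (n - 1)\<close>;
  the values of \<open>A\<close> beyond these are never used. Vectors of length \<open>n\<close> are finitely supported
  functions with support in \<open>{..<n}\<close>.
\<close>

definition mat_mult_vec :: "nat \<Rightarrow> (nat \<Rightarrow> int ^ 'm) \<Rightarrow> (nat \<Rightarrow>\<^sub>0 int) \<Rightarrow> int ^ 'm" where
  "mat_mult_vec n A v = (\<Sum>j<n. Poly_Mapping.lookup v j *s A j)"

lemma mat_mult_vec_diff:
  "mat_mult_vec n A (v - w) = mat_mult_vec n A v - mat_mult_vec n A w"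
  by (simp add: mat_mult_vec_def lookup_minus sum_subtractf)

definition lattice_of :: "nat \<Rightarrow> (nat \<Rightarrow> int ^ 'm) \<Rightarrow> (nat \<Rightarrow>\<^sub>0 int) set" where
  "lattice_of n A = {v. Poly_Mapping.keys v \<subseteq> {..<n} \<and> mat_mult_vec n A v = 0}"

definition toric_ideal :: "nat \<Rightarrow> (nat \<Rightarrow> int ^ 'm) \<Rightarrow> cpoly set" where
  "toric_ideal n A = Idl\<^bsub>poly_ring n\<^esub> {monomial u - monomial v | u v.
     Poly_Mapping.keys u \<subseteq> {..<n} \<and> Poly_Mapping.keys v \<subseteq> {..<n} \<and>
     mat_mult_vec n A (Poly_Mapping.map int u) = mat_mult_vec n A (Poly_Mapping.map int v)}"

text \<open>Here \<^const>\<open>nat\<close> truncates negative integers to \<open>0\<close>.\<close>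

definition pos_part :: "(nat \<Rightarrow>\<^sub>0 int) \<Rightarrow> (nat \<Rightarrow>\<^sub>0 nat)" where
  "pos_part v = Poly_Mapping.map nat v"

definition neg_part :: "(nat \<Rightarrow>\<^sub>0 int) \<Rightarrow> (nat \<Rightarrow>\<^sub>0 nat)" where
  "neg_part v = Poly_Mapping.map nat (- v)"

definition basis_ideal :: "nat \<Rightarrow> (nat \<Rightarrow>\<^sub>0 int) set \<Rightarrow> cpoly set" where
  "basis_ideal n B = Idl\<^bsub>poly_ring n\<^esub> ((\<lambda>v. monomial (pos_part v) - monomial (neg_part v)) ` B)"

definition rat_scale :: "rat \<Rightarrow> (nat \<Rightarrow>\<^sub>0 rat) \<Rightarrow> (nat \<Rightarrow>\<^sub>0 rat)" where
  "rat_scale c v = Poly_Mapping.map ((*) c) v"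

lemma lookup_rat_scale [simp]:
  "Poly_Mapping.lookup (rat_scale c v) i = c * Poly_Mapping.lookup v i"
  by (simp add: rat_scale_def Poly_Mapping.map.rep_eq when_def)

interpretation rat_vec: vector_space rat_scale
  by unfold_locales (rule poly_mapping_eqI, simp add: lookup_add algebra_simps)+

text \<open>
  Here \<open>m\<close> is the number of rows of \<open>A\<close>, which is to have rank \<open>m\<close>; so \<open>n - m\<close> is the rank of
  the lattice.
\<close>

definition is_rational_basis ::
  "nat \<Rightarrow> (nat \<Rightarrow> int ^ 'm) \<Rightarrow> (nat \<Rightarrow>\<^sub>0 int) set \<Rightarrow> bool" where
  "is_rational_basis n A B \<longleftrightarrow> B \<subseteq> lattice_of n A \<and> finite B \<and> card B + CARD('m) = n \<and>
     rat_vec.independent (Poly_Mapping.map rat_of_int ` B)"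

definition complete_intersection_basis_ideal :: "nat \<Rightarrow> (nat \<Rightarrow>\<^sub>0 int) set \<Rightarrow> bool" where
  "complete_intersection_basis_ideal n B \<longleftrightarrow>
     ideal_height (poly_ring n) (basis_ideal n B) = enat (card B)"

lemma basis_ideal_subset_toric_ideal:
  assumes "B \<subseteq> lattice_of n A"
  shows "basis_ideal n B \<subseteq> toric_ideal n A"
proof -
  have parts: "Poly_Mapping.keys (pos_part v) \<subseteq> {..<n} \<and> Poly_Mapping.keys (neg_part v) \<subseteq> {..<n} \<and>
      mat_mult_vec n A (Poly_Mapping.map int (pos_part v)) =
      mat_mult_vec n A (Poly_Mapping.map int (neg_part v))" if "v \<in> B" for v
  proof -
    have keys: "Poly_Mapping.keys v \<subseteq> {..<n}" and zero: "mat_mult_vec n A v = 0"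
      using assms that by (auto simp: lattice_of_def)
    have "Poly_Mapping.keys (pos_part v) \<subseteq> Poly_Mapping.keys v"
      "Poly_Mapping.keys (neg_part v) \<subseteq> Poly_Mapping.keys v"
      by (auto simp: pos_part_def neg_part_def in_keys_iff Poly_Mapping.map.rep_eq)
    moreover have "v = Poly_Mapping.map int (pos_part v) - Poly_Mapping.map int (neg_part v)"
      by (rule poly_mapping_eqI)
        (simp add: pos_part_def neg_part_def Poly_Mapping.map.rep_eq lookup_minus when_def)
    then have "mat_mult_vec n A v = mat_mult_vec n A (Poly_Mapping.map int (pos_part v)) -
        mat_mult_vec n A (Poly_Mapping.map int (neg_part v))"
      by (metis mat_mult_vec_diff)
    ultimately show ?thesis using keys zero by auto
  qed
  then have "(\<lambda>v. monomial (pos_part v) - monomial (neg_part v)) ` B \<subseteq>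
    {monomial u - monomial v | u v.
     Poly_Mapping.keys u \<subseteq> {..<n} \<and> Poly_Mapping.keys v \<subseteq> {..<n} \<and>
     mat_mult_vec n A (Poly_Mapping.map int u) = mat_mult_vec n A (Poly_Mapping.map int v)}"
    by blast
  then show ?thesis
    unfolding basis_ideal_def toric_ideal_def genideal_def by blast
qed

definition real_point :: "int ^ 'd \<Rightarrow> real ^ 'd" where
  "real_point a = (\<chi> i. real_of_int (a $ i))"

definition are_polytope_vertices :: "nat \<Rightarrow> (nat \<Rightarrow> int ^ 'd) \<Rightarrow> bool" where
  "are_polytope_vertices n a \<longleftrightarrow>
     (\<exists>P. polytope P \<and> {x. x extreme_point_of P} = (\<lambda>j. real_point (a j)) ` {..<n})"

text \<open>
  The column \<open>(1, a)\<close>. The rows are indexed by \<^typ>\<open>'d option\<close>, which has one element more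
  than \<^typ>\<open>'d\<close>; the index \<^const>\<open>None\<close> is that of the row of ones.
\<close>

definition homogenize :: "int ^ 'd \<Rightarrow> int ^ ('d option)" where
  "homogenize a = (\<chi> i. case i of None \<Rightarrow> 1 | Some k \<Rightarrow> a $ k)"

end

theory Submission
  imports Defs
begin

text \<open>
  If \<open>S\<close> is a set of variables such that every \<open>v \<in> B\<close> has both a positive and a negative
  coordinate in \<open>S\<close>, then \<open>J\<^sub>B\<close> lies in the prime ideal \<open>P\<^sub>S = (x\<^sub>i : i \<in> S)\<close>, whose height is
  at most \<open>|S|\<close>; so it suffices to find such an \<open>S\<close> with \<open>|S| = r - 1\<close>. As no vertex is a convex
  combination of the others, every \<open>v \<in> B\<close> has two positive and two negative coordinates. These
  \<open>2r \<le> 2n\<close> pairs are the edges of a graph on the \<open>n\<close> coordinates, which for large \<open>n\<close> has an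
  independent set of size \<open>d + 2\<close> since it is sparse; its complement is \<open>S\<close>.

  The height of \<open>P\<^sub>S\<close> is bounded by counting dimensions: if \<open>P \<subset> Q\<close> are ideals, \<open>P\<close> is prime and
  \<open>f \<in> Q - P\<close>, then \<open>X \<union> f Y\<close> is independent modulo \<open>P\<close> whenever \<open>X\<close> is independent modulo \<open>Q\<close>
  and \<open>Y\<close> modulo \<open>P\<close>. Hence each step down a chain of primes raises by one the exponent with which
  the number of independent polynomials grows with the degree. That exponent is \<open>n - |S|\<close>
  for \<open>P\<^sub>S\<close> and never exceeds \<open>n\<close>.
\<close>

section \<open>Independent sets in sparse graphs\<close>

text \<open>Averaging: \<open>E\<close> is the disjoint union of its fibres over \<open>V\<close>,
  so fibres that all had more than \<open>c\<close> elements would give more than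
  \<open>c * card V\<close> pairs.\<close>

lemma exists_low_degree_vertex:
  assumes "finite V" "V \<noteq> {}" "E \<subseteq> V \<times> V" "card E \<le> c * card V"
  shows "\<exists>x\<in>V. card (E `` {x}) \<le> c"
proof (rule ccontr)
  assume "\<not> ?thesis"
  then have less: "c < card (E `` {x})" if "x \<in> V" for x
    using that by auto
  have "c * card V = (\<Sum>x\<in>V. c)" by simp
  also have "\<dots> < (\<Sum>x\<in>V. card (E `` {x}))"
    using assms less by (intro sum_strict_mono) auto
  also have "\<dots> = card (Sigma V (\<lambda>x. E `` {x}))"
    using assms by (subst card_SigmaI) (auto intro: finite_subset[of _ V])
  also have "Sigma V (\<lambda>x. E `` {x}) = E"
    using assms by auto
  finally show False using assms by simp
qed

text \<open>Greedy choice: take a vertex of degree at most \<open>c\<close>, delete it with its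
  neighbours, and continue in the rest. At least half of a large graph survives the deletion, so the
  edge density at most doubles; hence the induction on \<open>k\<close> is for all \<open>c\<close>
  at once.\<close>

lemma sparse_graph_independent_set:
  fixes c k :: nat
  shows "\<exists>N. \<forall>V :: 'a set. \<forall>E. finite V \<longrightarrow> N \<le> card V \<longrightarrow> E \<subseteq> V \<times> V \<longrightarrow> sym E \<longrightarrow> irrefl E \<longrightarrow>
    card E \<le> c * card V \<longrightarrow> (\<exists>T\<subseteq>V. card T = k \<and> T \<times> T \<inter> E = {})"
proof (induction k arbitrary: c)
  case 0
  show ?case by (intro exI[of _ 0]) auto
next
  case (Suc k)
  obtain N where N: "\<And>(V :: 'a set) E. finite V \<Longrightarrow> N \<le> card V \<Longrightarrow> E \<subseteq> V \<times> V \<Longrightarrow> sym E \<Longrightarrow>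
      irrefl E \<Longrightarrow> card E \<le> (2 * c) * card V \<Longrightarrow> \<exists>T\<subseteq>V. card T = k \<and> T \<times> T \<inter> E = {}"
    using Suc.IH[of "2 * c"] by blast
  show ?case
  \<comment> \<open>At most \<open>c + 1\<close> vertices get deleted. The summand
    \<open>2 * (c + 1)\<close> ensures that at least half of \<open>V\<close> remains, and
    \<open>N\<close> that the rest is large enough for the induction hypothesis.\<close>
  proof (intro exI[of _ "N + 2 * (c + 1)"] allI impI)
    fix V :: "'a set" and E
    assume V: "finite V" "N + 2 * (c + 1) \<le> card V" and E: "E \<subseteq> V \<times> V" "sym E" "irrefl E"
      and card_E: "card E \<le> c * card V"
    obtain x where x: "x \<in> V" "card (E `` {x}) \<le> c"
      using exists_low_degree_vertex[of V E c] V E card_E by force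
    define V' where "V' = V - insert x (E `` {x})"
    define E' where "E' = E \<inter> V' \<times> V'"
    have fin: "finite (E `` {x})" "finite E"
      using V E by (auto intro: finite_subset[of _ V] finite_subset[of _ "V \<times> V"])
    have "card (insert x (E `` {x})) \<le> c + 1"
      using x fin by (simp add: card_insert_if)
    moreover have "card V - card (insert x (E `` {x})) \<le> card V'"
      unfolding V'_def by (rule diff_card_le_card_Diff) (use fin in auto)
    ultimately have card_V': "card V \<le> card V' + (c + 1)" by linarith
    have "card E' \<le> c * card V"
      using card_mono[of E E'] fin card_E by (auto simp: E'_def)
    also have "\<dots> \<le> c * (2 * card V')"
    proof (rule mult_le_mono2)
      show "card V \<le> 2 * card V'" using card_V' V(2) by simp
    qed
    finally have "card E' \<le> (2 * c) * card V'" by simp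
    moreover have "finite V'" "N \<le> card V'" "E' \<subseteq> V' \<times> V'"
      using V card_V' by (auto simp: V'_def E'_def)
    moreover have "sym E'" "irrefl E'"
      using E by (auto simp: E'_def sym_def irrefl_def)
    ultimately obtain T where T: "T \<subseteq> V'" "card T = k" "T \<times> T \<inter> E' = {}"
      using N[of V' E'] by blast
    have "x \<notin> T" "finite T"
      using T \<open>finite V'\<close> by (auto simp: V'_def intro: finite_subset)
    \<comment> \<open>\<open>T\<close> avoids the neighbours of \<open>x\<close>; symmetry excludes
      edges from \<open>T\<close> into \<open>x\<close>, irreflexivity a loop at
      \<open>x\<close>.\<close>
    moreover have "insert x T \<times> insert x T \<inter> E = {}"
      using T E unfolding V'_def E'_def sym_def irrefl_def by blast
    ultimately show "\<exists>T\<subseteq>V. card T = Suc k \<and> T \<times> T \<inter> E = {}"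
      using T x by (intro exI[of _ "insert x T"]) (auto simp: V'_def)
  qed
qed

section \<open>Independence modulo an ideal\<close>

lemma poly_ring_simps [simp]:
  "x \<oplus>\<^bsub>poly_ring n\<^esub> y = x + y" "x \<otimes>\<^bsub>poly_ring n\<^esub> y = x * y"
  "\<zero>\<^bsub>poly_ring n\<^esub> = 0" "\<one>\<^bsub>poly_ring n\<^esub> = 1"
  by (simp_all add: poly_ring_def)

lemma mem_carrier_poly_ring:
  "p \<in> carrier (poly_ring n) \<longleftrightarrow> (\<forall>u\<in>Poly_Mapping.keys p. Poly_Mapping.keys u \<subseteq> {..<n})"
  by (simp add: poly_ring_def)

definition const :: "complex \<Rightarrow> cpoly" where
  "const c = Poly_Mapping.single 0 c"

lemma const_simps:
  "const 0 = 0" "const 1 = 1" "const (c + d) = const c + const d" "const (c * d) = const c * const d"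
  "const (- c) = - const c"
  by (simp_all add: const_def single_add mult_single single_uminus)

lemma const_in_carrier: "const c \<in> carrier (poly_ring n)"
  by (auto simp: const_def mem_carrier_poly_ring split: if_splits)

lemma lookup_const_mult: "Poly_Mapping.lookup (const c * p) u = c * Poly_Mapping.lookup p u"
  unfolding const_def mult_map_scale_conv_mult[symmetric]
  by (simp add: Poly_Mapping.map.rep_eq when_def)

text \<open>Gives access to \<open>span\<close> and \<open>independent\<close> over the complex
  numbers.\<close>

lemma vector_space_const: "vector_space (\<lambda>c p. const c * p)"
  by unfold_locales (simp_all add: const_simps algebra_simps)

text \<open>Bounding each exponent separately, rather than the total degree, makes the number of
  monomials an exact power.\<close>

definition exponent_box :: "nat set \<Rightarrow> nat \<Rightarrow> (nat \<Rightarrow>\<^sub>0 nat) set" where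
  "exponent_box V D = {u. Poly_Mapping.keys u \<subseteq> V \<and> (\<forall>i. Poly_Mapping.lookup u i \<le> D)}"

lemma exponent_box_mono: "D \<le> D' \<Longrightarrow> exponent_box V D \<subseteq> exponent_box V D'"
  unfolding exponent_box_def by (auto intro: order_trans)

lemma card_exponent_box:
  assumes "finite V"
  shows "finite (exponent_box V D)" "card (exponent_box V D) = (D + 1) ^ card V"
proof -
  have "bij_betw (\<lambda>u. restrict (Poly_Mapping.lookup u) V) (exponent_box V D) (PiE V (\<lambda>_. {..D}))"
  proof (rule bij_betwI[where g = "\<lambda>f. \<Sum>i\<in>V. Poly_Mapping.single i (f i)"])
    have look: "Poly_Mapping.lookup (\<Sum>i\<in>V. Poly_Mapping.single i (f i)) j = (if j \<in> V then f j else 0)"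
      for f :: "nat \<Rightarrow> nat" and j
      using assms by (simp add: lookup_sum lookup_single when_def)
    show "(\<lambda>f. \<Sum>i\<in>V. Poly_Mapping.single i (f i)) \<in> PiE V (\<lambda>_. {..D}) \<rightarrow> exponent_box V D"
      by (auto simp: exponent_box_def look in_keys_iff PiE_def Pi_def split: if_splits)
    show "(\<Sum>i\<in>V. Poly_Mapping.single i (restrict (Poly_Mapping.lookup u) V i)) = u"
      if "u \<in> exponent_box V D" for u
      using that by (intro poly_mapping_eqI) (auto simp: look exponent_box_def in_keys_iff)
    show "restrict (Poly_Mapping.lookup (\<Sum>i\<in>V. Poly_Mapping.single i (f i))) V = f"
      if "f \<in> PiE V (\<lambda>_. {..D})" for f
      using that by (auto simp: look PiE_def extensional_def restrict_def)
    show "(\<lambda>u. restrict (Poly_Mapping.lookup u) V) \<in> exponent_box V D \<rightarrow> PiE V (\<lambda>_. {..D})"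
      by (auto simp: exponent_box_def)
  qed
  moreover have "finite (PiE V (\<lambda>_. {..D}))" "card (PiE V (\<lambda>_. {..D})) = (D + 1) ^ card V"
    using assms by (auto simp: card_PiE intro!: finite_PiE)
  ultimately show "finite (exponent_box V D)" "card (exponent_box V D) = (D + 1) ^ card V"
    using bij_betw_finite bij_betw_same_card by metis+
qed

definition poly_box :: "nat \<Rightarrow> nat \<Rightarrow> cpoly set" where
  "poly_box n D = {p. Poly_Mapping.keys p \<subseteq> exponent_box {..<n} D}"

lemma poly_box_subset_carrier: "poly_box n D \<subseteq> carrier (poly_ring n)"
  by (fastforce simp: poly_box_def exponent_box_def mem_carrier_poly_ring)

lemma poly_box_mono: "D \<le> D' \<Longrightarrow> poly_box n D \<subseteq> poly_box n D'"
  using exponent_box_mono unfolding poly_box_def by blast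

lemma poly_box_mult:
  assumes "p \<in> poly_box n D" "q \<in> poly_box n D'"
  shows "p * q \<in> poly_box n (D + D')"
proof -
  have "a + b \<in> exponent_box {..<n} (D + D')"
    if "a \<in> exponent_box {..<n} D" "b \<in> exponent_box {..<n} D'" for a b
    using that Poly_Mapping.keys_add[of a b]
    by (auto simp: exponent_box_def lookup_add intro!: add_mono)
  then show ?thesis
    using assms Poly_Mapping.keys_mult[of p q] unfolding poly_box_def by blast
qed

lemma carrier_subset_poly_box:
  assumes "p \<in> carrier (poly_ring n)"
  shows "\<exists>D. p \<in> poly_box n D"
proof -
  let ?X = "\<Union>u\<in>Poly_Mapping.keys p. Poly_Mapping.lookup u ` Poly_Mapping.keys u"
  \<comment> \<open>Inserting 0 makes this the maximum of a nonempty set even for constant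
    \<open>p\<close>.\<close>
  have "Poly_Mapping.lookup u i \<le> Max (insert 0 ?X)" if "u \<in> Poly_Mapping.keys p" for u i
    using that by (cases "i \<in> Poly_Mapping.keys u") (auto simp: in_keys_iff intro!: Max_ge)
  then show ?thesis
    using assms by (intro exI[of _ "Max (insert 0 ?X)"])
      (auto simp: poly_box_def exponent_box_def mem_carrier_poly_ring)
qed

text \<open>For an ideal \<open>P\<close>: the classes of the elements of \<open>X\<close> in the
  quotient by \<open>P\<close> are distinct and linearly independent, said without forming the
  quotient.\<close>

definition independent_mod :: "cpoly set \<Rightarrow> cpoly set \<Rightarrow> bool" where
  "independent_mod P X \<longleftrightarrow>
    finite X \<and> (\<forall>c. (\<Sum>x\<in>X. const (c x) * x) \<in> P \<longrightarrow> (\<forall>x\<in>X. c x = 0))"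

text \<open>Since \<open>0 \<in> P\<close>, independence modulo \<open>P\<close> implies linear
  independence, and the box is spanned by \<open>(D + 1) ^ n\<close> monomials.\<close>

lemma independent_mod_card_le:
  assumes X: "independent_mod P X" and P: "0 \<in> P" and box: "X \<subseteq> poly_box n D"
  shows "card X \<le> (D + 1) ^ n"
proof -
  interpret vector_space "\<lambda>c p. const c * p" by (rule vector_space_const)
  let ?M = "exponent_box {..<n} D"
  have ind: "independent X"
    using X P by (auto simp: dependent_finite independent_mod_def)
  have "p \<in> span (monomial ` ?M)" if "p \<in> X" for p
  proof -
    have keys: "Poly_Mapping.keys p \<subseteq> ?M"
      using that box by (auto simp: poly_box_def)
    have "p = (\<Sum>u\<in>?M. const (Poly_Mapping.lookup p u) * monomial u)"
    proof (rule poly_mapping_eqI)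
      fix w
      show "Poly_Mapping.lookup p w =
        Poly_Mapping.lookup (\<Sum>u\<in>?M. const (Poly_Mapping.lookup p u) * monomial u) w"
        using keys card_exponent_box(1)[of "{..<n}" D]
        by (auto simp: lookup_sum lookup_const_mult monomial_def lookup_single when_def in_keys_iff
            if_distrib cong: if_cong)
    qed
    also have "\<dots> \<in> span (monomial ` ?M)"
      by (intro span_sum span_scale span_base) auto
    finally show ?thesis .
  qed
  then have "card X \<le> card (monomial ` ?M)"
    using independent_span_bound[OF _ ind, of "monomial ` ?M"] card_exponent_box(1)[of "{..<n}" D]
    by auto
  also have "\<dots> \<le> card ?M"
    by (rule card_image_le) (simp add: card_exponent_box)
  finally show ?thesis by (simp add: card_exponent_box)
qed

text \<open>The multiples of \<open>f\<close> vanish modulo \<open>Q\<close>, so a relation modulo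
  \<open>P\<close>, read modulo \<open>Q\<close>, forces the coefficients on \<open>X\<close> to be
  0. What remains is \<open>f\<close> times a combination of \<open>Y\<close>, and primality of
  \<open>P\<close> cancels \<open>f\<close>.\<close>

lemma independent_mod_Un_mult:
  assumes P: "primeideal P (poly_ring n)" and Q: "ideal Q (poly_ring n)" and "P \<subseteq> Q"
    and f: "f \<in> Q" "f \<notin> P"
    and X: "independent_mod Q X" "X \<subseteq> carrier (poly_ring n)"
    and Y: "independent_mod P Y" "Y \<subseteq> carrier (poly_ring n)"
  shows "independent_mod P (X \<union> (*) f ` Y)" "card (X \<union> (*) f ` Y) = card X + card Y"
proof -
  interpret R: cring "poly_ring n" by (rule cring_poly_ring)
  interpret P: primeideal P "poly_ring n" by (rule P)
  interpret Q: ideal Q "poly_ring n" by (rule Q)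
  have fin: "finite X" "finite Y"
    using X Y by (auto simp: independent_mod_def)
  have fc: "f \<in> carrier (poly_ring n)"
    using f Q.Icarr by auto
  have comb: "(\<Sum>y\<in>Y. const (c y) * y) \<in> carrier (poly_ring n)" for c
  proof -
    have "(\<Sum>y\<in>Y'. const (c y) * y) \<in> carrier (poly_ring n)" if "finite Y'" "Y' \<subseteq> Y" for Y'
      using that
    proof (induction Y')
      case empty
      show ?case using R.zero_closed by simp
    next
      case (insert y Y')
      then show ?case
        using R.a_closed[of "const (c y) * y" "\<Sum>y\<in>Y'. const (c y) * y"]
          R.m_closed[OF const_in_carrier, of y "c y"] Y by auto
    qed
    then show ?thesis using fin by simp
  qed
  have fQ: "f * g \<in> Q" if "g \<in> carrier (poly_ring n)" for g
    using Q.I_r_closed[OF f(1) that] by simp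
  have "f \<noteq> 0"
    using f P.zero_closed by auto
  then have inj: "inj_on ((*) f) Y"
    by (auto simp: inj_on_def)
  \<comment> \<open>A common element would lie in \<open>Q\<close>, hence be a relation on
    \<open>X\<close> with a single coefficient 1.\<close>
  have disj: "X \<inter> (*) f ` Y = {}"
  proof (rule ccontr)
    assume "X \<inter> (*) f ` Y \<noteq> {}"
    then obtain y where y: "y \<in> Y" "f * y \<in> X" by auto
    have "(\<Sum>x\<in>X. const (if x = f * y then 1 else 0) * x) = f * y"
      using y fin by (simp add: const_simps if_distrib[of const] if_distrib[of "\<lambda>t. t * _"] cong: if_cong)
    then have "(\<Sum>x\<in>X. const (if x = f * y then 1 else 0) * x) \<in> Q"
      using fQ y Y by auto
    then show False
      using X(1) y(2) unfolding independent_mod_def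
      by (auto dest!: spec[of _ "\<lambda>x. if x = f * y then 1 else 0"])
  qed
  show "card (X \<union> (*) f ` Y) = card X + card Y"
    using disj fin inj by (simp add: card_Un_disjoint card_image)
  show "independent_mod P (X \<union> (*) f ` Y)"
    unfolding independent_mod_def
  proof (intro conjI allI impI)
    show "finite (X \<union> (*) f ` Y)" using fin by simp
    fix c
    let ?SX = "\<Sum>x\<in>X. const (c x) * x" and ?SY = "\<Sum>y\<in>Y. const (c (f * y)) * y"
    assume "(\<Sum>x\<in>X \<union> (*) f ` Y. const (c x) * x) \<in> P"
    also have "(\<Sum>x\<in>X \<union> (*) f ` Y. const (c x) * x) = ?SX + (\<Sum>y\<in>Y. const (c (f * y)) * (f * y))"
      using disj fin inj by (simp add: sum.union_disjoint sum.reindex)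
    also have "(\<Sum>y\<in>Y. const (c (f * y)) * (f * y)) = f * ?SY"
      by (simp add: sum_distrib_left algebra_simps)
    finally have sum_P: "?SX + f * ?SY \<in> P" .
    have "f * (- ?SY) \<in> Q"
      using fQ[of "const (- 1) * ?SY"] R.m_closed[OF const_in_carrier comb, of "- 1"]
      by (simp add: const_simps)
    then have "?SX \<in> Q"
      using Q.a_closed[of "?SX + f * ?SY" "f * (- ?SY)"] sum_P \<open>P \<subseteq> Q\<close> by auto
    then have cX: "\<forall>x\<in>X. c x = 0"
      using X by (simp add: independent_mod_def)
    then have "f * ?SY \<in> P"
      using sum_P by (simp add: const_simps)
    then have "?SY \<in> P"
      using P.I_prime[OF fc comb, of "\<lambda>y. c (f * y)"] f by auto
    then have "\<forall>y\<in>Y. c (f * y) = 0"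
      using Y(1) unfolding independent_mod_def by (auto dest!: spec[of _ "\<lambda>y. c (f * y)"])
    then show "\<forall>x\<in>X \<union> (*) f ` Y. c x = 0"
      using cX by auto
  qed
qed

section \<open>The height of an ideal generated by variables\<close>

text \<open>For an ideal \<open>P\<close>, a lower bound on the Gelfand-Kirillov dimension of the
  quotient: \<open>t ^ a\<close> independent classes in degrees linear in \<open>t\<close>. The
  exact count makes \<open>t\<close> stacked families have exactly \<open>t ^ Suc a\<close>
  elements.\<close>

definition growth_at_least :: "nat \<Rightarrow> cpoly set \<Rightarrow> nat \<Rightarrow> bool" where
  "growth_at_least n P a \<longleftrightarrow>
    (\<exists>C. \<forall>t. \<exists>X \<subseteq> poly_box n (C * t). independent_mod P X \<and> card X = t ^ a)"

lemma growth_at_least_le: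
  assumes "growth_at_least n P a" "0 \<in> P"
  shows "a \<le> n"
proof (rule ccontr)
  assume "\<not> a \<le> n"
  obtain C where C: "\<And>t. \<exists>X \<subseteq> poly_box n (C * t). independent_mod P X \<and> card X = t ^ a"
    using assms unfolding growth_at_least_def by blast
  \<comment> \<open>For \<open>t \<ge> 1\<close> the box has at most
    \<open>((C + 1) * t) ^ n\<close> monomials, which is less than \<open>t ^ Suc n\<close> once
    \<open>t\<close> exceeds \<open>(C + 1) ^ n\<close>.\<close>
  define t where "t = (C + 1) ^ n + 1"
  have "t ^ Suc n \<le> t ^ a"
    using \<open>\<not> a \<le> n\<close> by (intro power_increasing) (auto simp: t_def)
  also have "\<dots> \<le> (C * t + 1) ^ n"
    using C[of t] independent_mod_card_le assms(2) by metis
  also have "\<dots> \<le> ((C + 1) * t) ^ n"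
    by (intro power_mono) (auto simp: t_def)
  finally have "t * t ^ n \<le> (C + 1) ^ n * t ^ n"
    by (simp only: power_mult_distrib power_Suc)
  moreover have "t ^ n > 0" by (simp add: t_def)
  ultimately have "t \<le> (C + 1) ^ n"
    using mult_le_cancel2 by blast
  then show False by (simp add: t_def)
qed

text \<open>With \<open>f\<close> in \<open>Q\<close> but not in \<open>P\<close>, the families
  \<open>X\<close>, \<open>f X\<close>, \<open>f^2 X\<close>, ... are jointly independent modulo
  \<open>P\<close>. Stacking \<open>t\<close> of them multiplies the count by \<open>t\<close> and
  keeps the degree linear in \<open>t\<close>.\<close>

lemma growth_at_least_Suc:
  assumes P: "primeideal P (poly_ring n)" and Q: "ideal Q (poly_ring n)" and "P \<subset> Q"
    and growth: "growth_at_least n Q a"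
  shows "growth_at_least n P (Suc a)"
proof -
  interpret Q: ideal Q "poly_ring n" by (rule Q)
  obtain C where C: "\<And>t. \<exists>X \<subseteq> poly_box n (C * t). independent_mod Q X \<and> card X = t ^ a"
    using growth unfolding growth_at_least_def by blast
  obtain f where f: "f \<in> Q" "f \<notin> P"
    using \<open>P \<subset> Q\<close> by blast
  then obtain e where e: "f \<in> poly_box n e"
    using carrier_subset_poly_box Q.Icarr by blast
  have "\<exists>X \<subseteq> poly_box n ((C + e) * t). independent_mod P X \<and> card X = t ^ Suc a" for t
  proof -
    obtain X where X: "X \<subseteq> poly_box n (C * t)" "independent_mod Q X" "card X = t ^ a"
      using C by blast
    have "\<exists>Y \<subseteq> poly_box n (C * t + j * e). independent_mod P Y \<and> card Y = j * t ^ a" for j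
    proof (induction j)
      case 0
      show ?case by (intro exI[of _ "{}"]) (simp add: independent_mod_def)
    next
      case (Suc j)
      then obtain Y where Y: "Y \<subseteq> poly_box n (C * t + j * e)" "independent_mod P Y"
        "card Y = j * t ^ a"
        by blast
      have "f * y \<in> poly_box n (C * t + Suc j * e)" if "y \<in> Y" for y
        using poly_box_mult[OF e, of y "C * t + j * e"] Y(1) that by (auto simp: ac_simps)
      moreover have "X \<subseteq> poly_box n (C * t + Suc j * e)"
        using X(1) poly_box_mono[of "C * t" "C * t + Suc j * e"] by auto
      ultimately have "X \<union> (*) f ` Y \<subseteq> poly_box n (C * t + Suc j * e)" by auto
      moreover have "X \<subseteq> carrier (poly_ring n)" "Y \<subseteq> carrier (poly_ring n)"
        using X(1) Y(1) poly_box_subset_carrier by blast+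
      ultimately show ?case
        using independent_mod_Un_mult[OF P Q _ f X(2) _ Y(2)] X(3) Y(3) \<open>P \<subset> Q\<close>
        by (intro exI[of _ "X \<union> (*) f ` Y"]) auto
    qed
    from this[of t] show ?thesis by (simp add: algebra_simps)
  qed
  then show ?thesis unfolding growth_at_least_def by blast
qed

text \<open>The ideal generated by the variables in \<open>S\<close> (when
  \<open>S \<subseteq> {..<n}\<close>), described termwise so that membership can be read off the
  monomials.\<close>

definition variable_ideal :: "nat \<Rightarrow> nat set \<Rightarrow> cpoly set" where
  "variable_ideal n S = {p \<in> carrier (poly_ring n).
     \<forall>u\<in>Poly_Mapping.keys p. Poly_Mapping.keys u \<inter> S \<noteq> {}}"

lemma variable_ideal_add:
  assumes "p \<in> variable_ideal n S" "q \<in> variable_ideal n S"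
  shows "p + q \<in> variable_ideal n S"
  using assms Poly_Mapping.keys_add[of p q] unfolding variable_ideal_def mem_carrier_poly_ring
  by blast

lemma variable_ideal_mult:
  assumes p: "p \<in> variable_ideal n S" and q: "q \<in> carrier (poly_ring n)"
  shows "p * q \<in> variable_ideal n S"
proof -
  interpret R: cring "poly_ring n" by (rule cring_poly_ring)
  have "Poly_Mapping.keys w \<inter> S \<noteq> {}" if w: "w \<in> Poly_Mapping.keys (p * q)" for w
  proof -
    obtain a b where ab: "w = a + b" "a \<in> Poly_Mapping.keys p"
      using w Poly_Mapping.keys_mult[of p q] by blast
    then have "Poly_Mapping.keys a \<inter> S \<noteq> {}"
      using p by (auto simp: variable_ideal_def)
    then obtain i where "i \<in> S" "Poly_Mapping.lookup a i \<noteq> 0"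
      by (auto simp: in_keys_iff)
    then show ?thesis
      using ab by (auto simp: in_keys_iff lookup_add intro!: exI[of _ i])
  qed
  moreover have "p * q \<in> carrier (poly_ring n)"
    using R.m_closed[of p q] p q by (simp add: variable_ideal_def)
  ultimately show ?thesis by (simp add: variable_ideal_def)
qed

lemma ideal_variable_ideal: "ideal (variable_ideal n S) (poly_ring n)"
proof -
  interpret R: cring "poly_ring n" by (rule cring_poly_ring)
  have carr: "variable_ideal n S \<subseteq> carrier (poly_ring n)"
    by (auto simp: variable_ideal_def)
  show ?thesis
  proof (rule idealI)
    show "ring (poly_ring n)" by (rule R.ring_axioms)
    show "subgroup (variable_ideal n S) (add_monoid (poly_ring n))"
    proof (rule R.add.subgroupI)
      show "variable_ideal n S \<noteq> {}"
        using R.zero_closed by (auto simp: variable_ideal_def intro!: exI[of _ 0])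
      fix p assume p: "p \<in> variable_ideal n S"
      have "- p \<in> variable_ideal n S"
        using variable_ideal_mult[OF p const_in_carrier[of "- 1"]] by (simp add: const_simps)
      moreover have "\<ominus>\<^bsub>poly_ring n\<^esub> p = - p"
        using p carr \<open>- p \<in> variable_ideal n S\<close> by (intro R.minus_equality) auto
      ultimately show "\<ominus>\<^bsub>poly_ring n\<^esub> p \<in> variable_ideal n S" by simp
    qed (use carr variable_ideal_add in auto)
  qed (use variable_ideal_mult in \<open>auto simp: mult.commute\<close>)
qed

text \<open>Sorting the terms of \<open>p\<close> by whether they involve \<open>S\<close> gives a
  representative \<open>g\<close> of its class that is free of these variables.\<close>

lemma variable_free_part:
  assumes "p \<in> carrier (poly_ring n)"
  obtains g h where "p = g + h" "g \<in> carrier (poly_ring n)" "h \<in> variable_ideal n S"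
    "\<And>u. u \<in> Poly_Mapping.keys g \<Longrightarrow> Poly_Mapping.keys u \<inter> S = {}"
proof -
  define part where "part M =
    (\<Sum>u\<in>Poly_Mapping.keys p \<inter> M. Poly_Mapping.single u (Poly_Mapping.lookup p u))" for M
  have look: "Poly_Mapping.lookup (part M) u = (if u \<in> M then Poly_Mapping.lookup p u else 0)" for M u
    by (auto simp: part_def lookup_sum lookup_single when_def in_keys_iff)
  let ?M = "{u. Poly_Mapping.keys u \<inter> S = {}}"
  have keys: "Poly_Mapping.keys (part M) = Poly_Mapping.keys p \<inter> M" for M
    by (auto simp: in_keys_iff look split: if_splits)
  show thesis
  proof (rule that)
    show "p = part ?M + part (- ?M)"
      by (rule poly_mapping_eqI) (simp add: look lookup_add)
    show "part ?M \<in> carrier (poly_ring n)" "part (- ?M) \<in> variable_ideal n S"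
      using assms by (auto simp: mem_carrier_poly_ring variable_ideal_def keys)
    show "Poly_Mapping.keys u \<inter> S = {}" if "u \<in> Poly_Mapping.keys (part ?M)" for u
      using that by (simp add: keys)
  qed
qed

text \<open>If a product lies in the ideal, so does the product of the \<open>S\<close>-free parts.
  Being itself \<open>S\<close>-free, that product is 0, and polynomials have no zero
  divisors.\<close>

lemma primeideal_variable_ideal: "primeideal (variable_ideal n S) (poly_ring n)"
proof -
  have "1 \<in> carrier (poly_ring n)" "1 \<notin> variable_ideal n S"
    using keys_one[where ?'a = "nat \<Rightarrow>\<^sub>0 nat" and ?'b = complex]
    unfolding variable_ideal_def mem_carrier_poly_ring by auto
  then have proper: "carrier (poly_ring n) \<noteq> variable_ideal n S" by blast
  show ?thesis
  proof (rule primeidealI[OF ideal_variable_ideal cring_poly_ring proper])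
    fix p q
    assume p: "p \<in> carrier (poly_ring n)" and q: "q \<in> carrier (poly_ring n)"
      and pq: "p \<otimes>\<^bsub>poly_ring n\<^esub> q \<in> variable_ideal n S"
    obtain g h where gh: "p = g + h" "g \<in> carrier (poly_ring n)" "h \<in> variable_ideal n S"
      "\<And>u. u \<in> Poly_Mapping.keys g \<Longrightarrow> Poly_Mapping.keys u \<inter> S = {}"
      by (rule variable_free_part[OF p]) blast
    obtain g' h' where gh': "q = g' + h'" "g' \<in> carrier (poly_ring n)" "h' \<in> variable_ideal n S"
      "\<And>u. u \<in> Poly_Mapping.keys g' \<Longrightarrow> Poly_Mapping.keys u \<inter> S = {}"
      by (rule variable_free_part[OF q]) blast
    \<comment> \<open>This is the difference of \<open>p * q\<close> and
      \<open>g * g'\<close>.\<close>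
    have "h' * g + h * q \<in> variable_ideal n S"
      using gh gh' q by (intro variable_ideal_add variable_ideal_mult)
    then have "(h' * g + h * q) * const (- 1) \<in> variable_ideal n S"
      by (rule variable_ideal_mult) (rule const_in_carrier)
    then have "- (h' * g + h * q) \<in> variable_ideal n S"
      by (simp add: const_simps)
    moreover have "g * g' = p * q + - (h' * g + h * q)"
      by (simp add: gh gh' algebra_simps)
    ultimately have "g * g' \<in> variable_ideal n S"
      using variable_ideal_add[of "p * q"] pq by simp
    moreover have "Poly_Mapping.keys w \<inter> S = {}" if w: "w \<in> Poly_Mapping.keys (g * g')" for w
    proof -
      obtain a b where "w = a + b" "a \<in> Poly_Mapping.keys g" "b \<in> Poly_Mapping.keys g'"
        using w Poly_Mapping.keys_mult[of g g'] by blast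
      then show ?thesis
        using gh(4) gh'(4) Poly_Mapping.keys_add[of a b] by blast
    qed
    ultimately have "Poly_Mapping.keys (g * g') = {}"
      unfolding variable_ideal_def by blast
    then have "g * g' = 0" by (metis keys_eq_empty)
    then have "g = 0 \<or> g' = 0" by simp
    then show "p \<in> variable_ideal n S \<or> q \<in> variable_ideal n S"
      using gh gh' by auto
  qed
qed

text \<open>Distinct monomials in the variables outside \<open>S\<close> are independent modulo the
  ideal, as no element of the ideal contains such a monomial.\<close>

lemma growth_at_least_variable_ideal:
  assumes "S \<subseteq> {..<n}"
  shows "growth_at_least n (variable_ideal n S) (n - card S)"
  unfolding growth_at_least_def
proof (rule exI[of _ 1], rule allI)
  fix t
  let ?V = "{..<n} - S"
  let ?M = "exponent_box ?V t"
  have fin: "finite S" using assms finite_subset by blast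
  have inj: "inj monomial" 
    by (auto intro!: injI simp: monomial_def dest: arg_cong[where f = Poly_Mapping.keys])
  \<comment> \<open>The box holds \<open>(t + 1) ^ (n - card S)\<close> monomials; a subset of
    exactly the required size is chosen.\<close>
  have "t ^ (n - card S) \<le> (t + 1) ^ (n - card S)"
    by (intro power_mono) auto
  also have "\<dots> = card (monomial ` ?M)"
    using card_exponent_box(2)[of ?V t] assms fin inj
    by (simp add: card_Diff_subset card_image inj_on_subset[OF inj])
  finally obtain X where X: "X \<subseteq> monomial ` ?M" "card X = t ^ (n - card S)" "finite X"
    using obtain_subset_with_card_n by metis
  have "independent_mod (variable_ideal n S) X"
    unfolding independent_mod_def
  proof (intro conjI allI impI ballI)
    fix c x
    assume comb: "(\<Sum>x\<in>X. const (c x) * x) \<in> variable_ideal n S" and x: "x \<in> X"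
    then obtain u where u: "x = monomial u" "u \<in> ?M"
      using X by auto
    have "Poly_Mapping.lookup (const (c y) * y) u = (if y = x then c x else 0)" if "y \<in> X" for y
    proof -
      obtain w where w: "y = monomial w" using X \<open>y \<in> X\<close> by auto
      have "w = u \<longleftrightarrow> y = x" using inj w u by (auto dest: injD)
      then show ?thesis using w u
        by (auto simp: lookup_const_mult monomial_def lookup_single)
    qed
    then have "Poly_Mapping.lookup (\<Sum>x\<in>X. const (c x) * x) u = c x"
      using x X by (simp add: lookup_sum)
    moreover have "u \<notin> Poly_Mapping.keys (\<Sum>x\<in>X. const (c x) * x)"
      using comb u unfolding variable_ideal_def exponent_box_def by blast
    ultimately show "c x = 0" by (simp add: in_keys_iff)
  qed (fact X)
  moreover have "X \<subseteq> poly_box n (1 * t)"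
    using X by (fastforce simp: poly_box_def exponent_box_def monomial_def)
  ultimately show "\<exists>X \<subseteq> poly_box n (1 * t). independent_mod (variable_ideal n S) X \<and>
      card X = t ^ (n - card S)"
    using X by blast
qed

text \<open>Descending a chain of \<open>k\<close> strict inclusions raises the growth exponent from
  \<open>n - card S\<close> to \<open>n - card S + k\<close>, which cannot exceed
  \<open>n\<close>.\<close>

lemma prime_height_variable_ideal_le:
  assumes "S \<subseteq> {..<n}"
  shows "prime_height (poly_ring n) (variable_ideal n S) \<le> enat (card S)"
  unfolding prime_height_def
proof (rule Sup_least, clarify)
  fix k and C :: "nat \<Rightarrow> cpoly set"
  assume prime: "\<forall>i\<le>k. primeideal (C i) (poly_ring n)" and chain: "\<forall>i<k. C i \<subset> C (Suc i)"
    and top: "C k = variable_ideal n S"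
  have "growth_at_least n (C (k - j)) (n - card S + j)" if "j \<le> k" for j
    using that
  proof (induction j)
    case 0
    show ?case using growth_at_least_variable_ideal[OF assms] top by simp
  next
    case (Suc j)
    then have "C (k - Suc j) \<subset> C (k - j)"
      using chain[rule_format, of "k - Suc j"] by (simp add: Suc_diff_Suc)
    moreover have "primeideal (C (k - Suc j)) (poly_ring n)" "ideal (C (k - j)) (poly_ring n)"
      using prime by (auto intro: primeideal.axioms(1))
    ultimately show ?case
      using growth_at_least_Suc[of "C (k - Suc j)" n "C (k - j)"] Suc by simp
  qed
  from this[of k] have "growth_at_least n (C 0) (n - card S + k)" by simp
  moreover have "0 \<in> C 0"
    using prime additive_subgroup.zero_closed[of "C 0" "poly_ring n"]
    by (auto dest: primeideal.axioms(1) ideal.axioms(1))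
  ultimately have "n - card S + k \<le> n" by (rule growth_at_least_le)
  moreover have "card S \<le> n"
    using card_mono[OF _ assms] by simp
  ultimately show "enat k \<le> enat (card S)" by simp
qed

section \<open>Sign patterns of affine relations between vertices\<close>

text \<open>With a single positive coordinate \<open>i\<close>, solving the relation for
  \<open>a i\<close> would make it a convex combination of the other vertices.\<close>

lemma two_positive_coordinates:
  fixes a :: "nat \<Rightarrow> int ^ 'd::finite"
  assumes inj: "inj_on a {..<n}" and vert: "are_polytope_vertices n a"
    and v: "v \<in> lattice_of n (\<lambda>j. homogenize (a j))" "v \<noteq> 0"
  shows "\<exists>i<n. \<exists>j<n. i \<noteq> j \<and> Poly_Mapping.lookup v i > 0 \<and> Poly_Mapping.lookup v j > 0"
proof (rule ccontr)
  assume not_two: "\<not> ?thesis"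
  let ?v = "Poly_Mapping.lookup v"
  have keys: "Poly_Mapping.keys v \<subseteq> {..<n}"
    and rel: "(\<Sum>j<n. ?v j *s homogenize (a j)) = 0"
    using v by (auto simp: lattice_of_def mat_mult_vec_def)
  have sum0: "(\<Sum>j<n. ?v j) = 0"
    using arg_cong[OF rel, of "\<lambda>w. w $ None"] by (simp add: homogenize_def)
  have suma: "(\<Sum>j<n. ?v j * a j $ k) = 0" for k
    using arg_cong[OF rel, of "\<lambda>w. w $ Some k"] by (simp add: homogenize_def)
  \<comment> \<open>Nonpositive coordinates with sum 0 would all vanish, against
    \<open>v \<noteq> 0\<close>.\<close>
  have "\<exists>i<n. ?v i > 0"
  proof (rule ccontr)
    assume "\<not> ?thesis"
    then have "\<And>j. j < n \<Longrightarrow> 0 \<le> - ?v j" by force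
    then have "\<forall>j\<in>{..<n}. - ?v j = 0"
      using sum_nonneg_eq_0_iff[of "{..<n}" "\<lambda>j. - ?v j"] sum0 by (auto simp: sum_negf)
    then have "?v j = 0" for j
      using keys by (cases "j < n") (auto simp: in_keys_iff)
    then show False using v(2) by (auto intro: poly_mapping_eqI)
  qed
  then obtain i where i: "i < n" "?v i > 0" by blast
  then have neg: "?v j \<le> 0" if "j < n" "j \<noteq> i" for j
    using not_two that by force
  define J where "J = {..<n} - {i}"
  have split: "(\<Sum>j<n. g j) = g i + (\<Sum>j\<in>J. g j)" for g :: "nat \<Rightarrow> int"
    using i by (simp add: J_def sum.remove)
  \<comment> \<open>The row of ones makes these weights sum to 1; the other rows give the
    combination.\<close>
  let ?w = "\<lambda>j. real_of_int (- ?v j) / real_of_int (?v i)"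
  have "(\<Sum>j\<in>J. - ?v j) = ?v i"
    using sum0 split[of ?v] by (simp add: sum_negf)
  then have "(\<Sum>j\<in>J. real_of_int (- ?v j)) = real_of_int (?v i)"
    by (metis of_int_sum)
  then have w1: "(\<Sum>j\<in>J. ?w j) = 1"
    using i by (simp only: sum_divide_distrib[symmetric]) simp
  have wa: "(\<Sum>j\<in>J. ?w j *\<^sub>R real_point (a j)) = real_point (a i)"
  proof (rule vec_eq_iff[THEN iffD2], rule allI)
    fix k
    have "(\<Sum>j\<in>J. - ?v j * a j $ k) = ?v i * a i $ k"
      using suma[of k] split[of "\<lambda>j. ?v j * a j $ k"] by (simp add: sum_negf)
    then have "(\<Sum>j\<in>J. real_of_int (- ?v j) * real_of_int (a j $ k)) =
        real_of_int (?v i) * real_of_int (a i $ k)"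
      by (metis (mono_tags, lifting) of_int_mult of_int_sum sum.cong)
    then have "(\<Sum>j\<in>J. real_of_int (- ?v j) * real_of_int (a j $ k)) / real_of_int (?v i) =
        real_of_int (a i $ k)"
      using i by simp
    then show "(\<Sum>j\<in>J. ?w j *\<^sub>R real_point (a j)) $ k = real_point (a i) $ k"
      by (simp add: real_point_def sum_divide_distrib)
  qed
  obtain P where P: "polytope P" "{x. x extreme_point_of P} = (\<lambda>j. real_point (a j)) ` {..<n}"
    using vert by (auto simp: are_polytope_vertices_def)
  have ext: "real_point (a j) extreme_point_of P" if "j < n" for j
    using P(2) that by blast
  \<comment> \<open>Removing an extreme point preserves convexity, so no convex combination of the
    remaining vertices can equal it.\<close>
  have conv: "convex (P - {real_point (a i)})"
    using extreme_point_of_stillconvex polytope_imp_convex[OF P(1)] ext i by blast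
  have "real_point (a j) \<in> P - {real_point (a i)}" if "j \<in> J" for j
  proof -
    have "a j \<noteq> a i"
      using that i inj by (auto simp: J_def dest: inj_onD)
    then have "real_point (a j) \<noteq> real_point (a i)"
      by (auto simp: real_point_def vec_eq_iff)
    then show ?thesis
      using ext[of j] that by (auto simp: J_def extreme_point_of_def)
  qed
  moreover have "0 \<le> ?w j" if "j \<in> J" for j
    using neg[of j] that i by (auto simp: J_def divide_nonpos_pos)
  ultimately have "(\<Sum>j\<in>J. ?w j *\<^sub>R real_point (a j)) \<in> P - {real_point (a i)}"
    using w1 by (intro convex_sum[OF _ conv]) (auto simp: J_def)
  then show False using wa by simp
qed

lemma uminus_in_lattice_of: "v \<in> lattice_of n A \<Longrightarrow> - v \<in> lattice_of n A"
  using mat_mult_vec_diff[of n A 0 v] by (simp add: lattice_of_def mat_mult_vec_def)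

text \<open>Needed because the sign pattern of a relation is controlled only for nonzero
  vectors.\<close>

lemma zero_not_in_rational_basis:
  assumes "is_rational_basis n A B"
  shows "0 \<notin> B"
proof
  assume "0 \<in> B"
  moreover have "Poly_Mapping.map rat_of_int 0 = 0"
    by (simp add: map_eq_zero_iff)
  ultimately have "0 \<in> Poly_Mapping.map rat_of_int ` B"
    by (metis imageI)
  then show False
    using assms rat_vec.dependent_zero by (auto simp: is_rational_basis_def)
qed

section \<open>Basis ideals of vertex configurations\<close>

text \<open>Both monomials of each generator contain a variable from \<open>S\<close>, so the prime
  ideal of \<open>S\<close> is one of those over which the infimum is taken.\<close>

lemma ideal_height_basis_ideal_le:
  assumes S: "S \<subseteq> {..<n}" and B: "B \<subseteq> lattice_of n A"
    and mixed: "\<And>v. v \<in> B \<Longrightarrow>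
      (\<exists>i\<in>S. Poly_Mapping.lookup v i > 0) \<and> (\<exists>i\<in>S. Poly_Mapping.lookup v i < 0)"
  shows "ideal_height (poly_ring n) (basis_ideal n B) \<le> enat (card S)"
proof -
  interpret R: cring "poly_ring n" by (rule cring_poly_ring)
  have "monomial (pos_part v) - monomial (neg_part v) \<in> variable_ideal n S" if "v \<in> B" for v
  proof -
    have mon: "Poly_Mapping.keys (monomial (pos_part v) - monomial (neg_part v)) \<subseteq>
        {pos_part v, neg_part v}"
      using keys_diff[of "monomial (pos_part v)" "monomial (neg_part v)"] by (auto simp: monomial_def)
    have parts: "Poly_Mapping.keys (pos_part v) = {i. Poly_Mapping.lookup v i > 0}"
      "Poly_Mapping.keys (neg_part v) = {i. Poly_Mapping.lookup v i < 0}"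
      by (auto simp: pos_part_def neg_part_def in_keys_iff Poly_Mapping.map.rep_eq when_def split: if_splits)
    have "Poly_Mapping.keys v \<subseteq> {..<n}"
      using B that by (auto simp: lattice_of_def)
    then have "{i. Poly_Mapping.lookup v i > 0} \<subseteq> {..<n}" "{i. Poly_Mapping.lookup v i < 0} \<subseteq> {..<n}"
      by (auto simp: in_keys_iff subset_iff)
    then have "Poly_Mapping.keys u \<subseteq> {..<n} \<and> Poly_Mapping.keys u \<inter> S \<noteq> {}"
      if "u \<in> {pos_part v, neg_part v}" for u
      using that mixed[OF \<open>v \<in> B\<close>] by (auto simp: parts)
    then show ?thesis
      using mon unfolding variable_ideal_def mem_carrier_poly_ring by blast
  qed
  then have "basis_ideal n B \<subseteq> variable_ideal n S"
    unfolding basis_ideal_def by (intro R.genideal_minimal ideal_variable_ideal) auto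
  then have "ideal_height (poly_ring n) (basis_ideal n B) \<le>
      prime_height (poly_ring n) (variable_ideal n S)"
    unfolding ideal_height_def using primeideal_variable_ideal by (intro Inf_lower) auto
  also have "\<dots> \<le> enat (card S)"
    by (rule prime_height_variable_ideal_le[OF S])
  finally show ?thesis .
qed

theorem theorem3p1:
  assumes "CARD('d::finite) \<ge> 2"
  shows "\<exists>N :: nat. \<forall>n \<ge> N. \<forall>a :: nat \<Rightarrow> int ^ 'd.
    inj_on a {..<n} \<longrightarrow>
    are_polytope_vertices n a \<longrightarrow>
    group_closure ((\<lambda>j. homogenize (a j)) ` {..<n}) = UNIV \<longrightarrow>
    (let A = (\<lambda>j. homogenize (a j)) in
      \<not> (\<exists>B. is_rational_basis n A B \<and> basis_ideal n B \<subseteq> toric_ideal n A \<and>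
             complete_intersection_basis_ideal n B))"
proof -
  \<comment> \<open>The factor 4 is 2 for the signs of each basis vector times 2 for the
    orientations of each edge. Since \<open>card B\<close> is \<open>n - CARD('d) - 1\<close>, a set
    of size \<open>CARD('d) + 2\<close> has a complement with one element fewer than
    \<open>B\<close>.\<close>
  obtain N where N: "\<And>(V :: nat set) E. finite V \<Longrightarrow> N \<le> card V \<Longrightarrow> E \<subseteq> V \<times> V \<Longrightarrow> sym E \<Longrightarrow>
      irrefl E \<Longrightarrow> card E \<le> 4 * card V \<Longrightarrow> \<exists>T\<subseteq>V. card T = CARD('d) + 2 \<and> T \<times> T \<inter> E = {}"
    using sparse_graph_independent_set[of 4 "CARD('d) + 2", where 'a = nat] by blast
  show ?thesis
  proof (intro exI[of _ N] allI impI, unfold Let_def, intro notI, elim exE conjE)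
    fix n :: nat and a :: "nat \<Rightarrow> int ^ 'd" and B
    assume n: "N \<le> n" and inj: "inj_on a {..<n}" and vert: "are_polytope_vertices n a"
      and basis: "is_rational_basis n (\<lambda>j. homogenize (a j)) B"
      and ci: "complete_intersection_basis_ideal n B"
    have B: "B \<subseteq> lattice_of n (\<lambda>j. homogenize (a j))" "finite B" "card B + (CARD('d) + 1) = n"
      using basis by (auto simp: is_rational_basis_def)
    \<comment> \<open>Positive coordinates of \<open>- v\<close> are negative ones of
      \<open>v\<close>, so both signs are treated at once.\<close>
    define B' where "B' = B \<union> uminus ` B"
    have "\<exists>e. fst e < n \<and> snd e < n \<and> fst e \<noteq> snd e \<and>
        Poly_Mapping.lookup v (fst e) > 0 \<and> Poly_Mapping.lookup v (snd e) > 0" if "v \<in> B'" for v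
    proof -
      have "v \<in> lattice_of n (\<lambda>j. homogenize (a j))" "v \<noteq> 0"
        using that B(1) uminus_in_lattice_of zero_not_in_rational_basis[OF basis]
        by (auto simp: B'_def)
      then show ?thesis
        using two_positive_coordinates[OF inj vert, of v] by (metis fst_conv snd_conv)
    qed
    then obtain e where e: "\<And>v. v \<in> B' \<Longrightarrow> fst (e v) < n \<and> snd (e v) < n \<and>
        fst (e v) \<noteq> snd (e v) \<and>
        Poly_Mapping.lookup v (fst (e v)) > 0 \<and> Poly_Mapping.lookup v (snd (e v)) > 0"
      by metis
    define E where "E = e ` B' \<union> (e ` B')\<inverse>"
    have "card B' \<le> card B + card B"
      unfolding B'_def using card_image_le[OF B(2), of uminus] card_Un_le[of B "uminus ` B"]
      by linarith
    moreover have "finite B'"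
      using B(2) by (simp add: B'_def)
    then have "card E \<le> card B' + card B'"
      unfolding E_def using card_image_le[of B' e] card_Un_le[of "e ` B'" "(e ` B')\<inverse>"]
      by (simp add: card_inverse)
    ultimately have "card E \<le> 4 * n"
      using B(3) by linarith
    moreover have "E \<subseteq> {..<n} \<times> {..<n}"
    proof -
      have "e ` B' \<subseteq> {..<n} \<times> {..<n}"
        using e by (simp add: image_subset_iff mem_Times_iff)
      then show ?thesis by (auto simp: E_def)
    qed
    moreover have "sym E"
      by (auto simp: E_def sym_def)
    moreover have "irrefl E"
    proof (rule irreflI)
      show "(x, x) \<notin> E" for x
      proof
        assume "(x, x) \<in> E"
        then have "(x, x) \<in> e ` B'" by (auto simp: E_def)
        then obtain v where "v \<in> B'" "e v = (x, x)" by (metis imageE)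
        then show False using e[of v] by simp
      qed
    qed
    ultimately obtain T where T: "T \<subseteq> {..<n}" "card T = CARD('d) + 2" "T \<times> T \<inter> E = {}"
      using N[of "{..<n}" E] n by (metis card_lessThan finite_lessThan)
    \<comment> \<open>The complement of an independent set meets every edge, hence contains a
      positive coordinate of each vector in \<open>B'\<close>.\<close>
    let ?S = "{..<n} - T"
    have "(\<exists>k\<in>?S. Poly_Mapping.lookup v k > 0) \<and> (\<exists>k\<in>?S. Poly_Mapping.lookup v k < 0)" if "v \<in> B" for v
    proof -
      have "\<exists>k\<in>?S. Poly_Mapping.lookup w k > 0" if w: "w \<in> B'" for w
      proof -
        have "e w \<in> E" using w by (simp add: E_def)
        then have "fst (e w) \<notin> T \<or> snd (e w) \<notin> T"
          using T(3) by (metis disjoint_iff mem_Times_iff)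
        then show ?thesis using e[OF w] by auto
      qed
      from this[of v] this[of "- v"] that show ?thesis by (auto simp: B'_def)
    qed
    then have "ideal_height (poly_ring n) (basis_ideal n B) \<le> enat (card ?S)"
      by (intro ideal_height_basis_ideal_le[OF _ B(1)]) auto
    moreover have "card ?S < card B"
      using T B(3) card_mono[OF _ T(1)] by (simp add: card_Diff_subset finite_subset[OF T(1)])
    ultimately show False
      using ci by (simp add: complete_intersection_basis_ideal_def)
  qed
qed

end
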